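(* Every formula $\phi\in\mathsf{L}_\mu$ is equivalent to a formula $\psi$ such that both $\widehat{\psi}$ and $\psi^{\flat}$ belong to $\mathcal{C}_1(x)$. Moreover, $\psi$ can be chosen well-named.
   Context: $\mathsf{L}_\mu$ (over a finite action set $Act$ and countable variable set $Prop$) is generated by $\phi ::= y \mid \neg y \mid \top \mid \phi\wedge\phi \mid \bot \mid \phi\vee\phi \mid \langle a\rangle\phi \mid [a]\phi \mid \mu_z.\phi \mid \nu_z.\phi$ ($z$ not under a negation in the fixed-point clauses), with standard Kripke semantics; equivalence means same denotation in every model. A formula is well-named if no bound variable is also free and each bound variable $z$ is bound by a unique subformula occurrence of the form $\mu_z.\psi'$ or $\nu_z.\psi'$. For a formula $\psi$ in which $x$ has no bound occurrences, and a fresh variable $\bar{x}$, $\widehat{\psi}$ is defined inductively by: $\widehat{y}=y$, $\widehat{\neg y}=\neg y$, $\widehat\top=\top$, $\widehat\bot=\bot$, $\widehat{\psi_0\,@\,\psi_1}=\widehat{\psi_0}\,@\,\widehat{\psi_1}$ for $@\in\{\wedge,\vee\}$, $\widehat{\langle a\rangle\psi}=\langle a\rangle\widehat\psi$, $\widehat{[a]\psi}=[a]\,\psi[\bar x/x]$, $\widehat{Q_z.\psi}=Q_z.\widehat\psi$ for $Q\in\{\mu,\nu\}$ (thus the free occurrences of $x$ lying under some box modality are renamed $\bar x$). Then $\psi^\flat:=\widehat\psi[\bot/\bar x]$. For a set $X$ of variables, $\mathcal{C}_1(X)$ is generated by $\phi ::= x \mid \chi' \mid \top\mid\bot\mid \phi\wedge\phi\mid\phi\vee\phi\mid\langle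 a\rangle\phi\mid \mu_z.\chi\mid\nu_z.\chi$, where $x\in X$, $\chi'\in\mathsf{L}_\mu$ contains no variable of $X$, and $\chi\in\mathcal{C}_1(X\cup\{z\})$; $\mathcal{C}_1(x):=\mathcal{C}_1(\{x\})$.
   Formalization: The formula φ is assumed to contain x only positively (for φ = ¬x the claim fails), and equivalence is over all models with states in one arbitrary infinite set, which by the finite model property gives equivalence in every model. *)

theory Defs
  imports "HOL-Library.Countable" "HOL-Library.Infinite_Typeclass"
begin

datatype ('p, 'a) form =
    Var 'p
  | NVar 'p
  | Top
  | Conj "('p, 'a) form" "('p, 'a) form"
  | Bot
  | Disj "('p, 'a) form" "('p, 'a) form"
  | Dia 'a "('p, 'a) form"
  | Box 'a "('p, 'a) form"
  | Mu 'p "('p, 'a) form"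
  | Nu 'p "('p, 'a) form"

fun vars :: "('p, 'a) form \<Rightarrow> 'p set" where
  "vars (Var y) = {y}"
| "vars (NVar y) = {y}"
| "vars Top = {}"
| "vars (Conj \<phi> \<psi>) = vars \<phi> \<union> vars \<psi>"
| "vars Bot = {}"
| "vars (Disj \<phi> \<psi>) = vars \<phi> \<union> vars \<psi>"
| "vars (Dia a \<phi>) = vars \<phi>"
| "vars (Box a \<phi>) = vars \<phi>"
| "vars (Mu z \<phi>) = insert z (vars \<phi>)"
| "vars (Nu z \<phi>) = insert z (vars \<phi>)"

fun free_vars :: "('p, 'a) form \<Rightarrow> 'p set" where
  "free_vars (Var y) = {y}"
| "free_vars (NVar y) = {y}"
| "free_vars Top = {}"
| "free_vars (Conj \<phi> \<psi>) = free_vars \<phi> \<union> free_vars \<psi>"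
| "free_vars Bot = {}"
| "free_vars (Disj \<phi> \<psi>) = free_vars \<phi> \<union> free_vars \<psi>"
| "free_vars (Dia a \<phi>) = free_vars \<phi>"
| "free_vars (Box a \<phi>) = free_vars \<phi>"
| "free_vars (Mu z \<phi>) = free_vars \<phi> - {z}"
| "free_vars (Nu z \<phi>) = free_vars \<phi> - {z}"

fun neg_vars :: "('p, 'a) form \<Rightarrow> 'p set" where
  "neg_vars (Var y) = {}"
| "neg_vars (NVar y) = {y}"
| "neg_vars Top = {}"
| "neg_vars (Conj \<phi> \<psi>) = neg_vars \<phi> \<union> neg_vars \<psi>"
| "neg_vars Bot = {}"
| "neg_vars (Disj \<phi> \<psi>) = neg_vars \<phi> \<union> neg_vars \<psi>"
| "neg_vars (Dia a \<phi>) = neg_vars \<phi>"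
| "neg_vars (Box a \<phi>) = neg_vars \<phi>"
| "neg_vars (Mu z \<phi>) = neg_vars \<phi>"
| "neg_vars (Nu z \<phi>) = neg_vars \<phi>"

definition positive_in :: "'p \<Rightarrow> ('p, 'a) form \<Rightarrow> bool" where
  "positive_in x \<phi> \<longleftrightarrow> x \<notin> neg_vars \<phi>"

inductive L_mu :: "('p, 'a) form \<Rightarrow> bool" where
  "L_mu (Var y)"
| "L_mu (NVar y)"
| "L_mu Top"
| "L_mu \<phi> \<Longrightarrow> L_mu \<psi> \<Longrightarrow> L_mu (Conj \<phi> \<psi>)"
| "L_mu Bot"
| "L_mu \<phi> \<Longrightarrow> L_mu \<psi> \<Longrightarrow> L_mu (Disj \<phi> \<psi>)"
| "L_mu \<phi> \<Longrightarrow> L_mu (Dia a \<phi>)"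
| "L_mu \<phi> \<Longrightarrow> L_mu (Box a \<phi>)"
| "L_mu \<phi> \<Longrightarrow> positive_in z \<phi> \<Longrightarrow> L_mu (Mu z \<phi>)"
| "L_mu \<phi> \<Longrightarrow> positive_in z \<phi> \<Longrightarrow> L_mu (Nu z \<phi>)"

text \<open>
  The set of states of a model is an arbitrary subset of the state type.
\<close>

definition kripke_model ::
    "'s set \<Rightarrow> ('a \<Rightarrow> ('s \<times> 's) set) \<Rightarrow> ('p \<Rightarrow> 's set) \<Rightarrow> bool" where
  "kripke_model S R v \<longleftrightarrow> (\<forall>a. R a \<subseteq> S \<times> S) \<and> (\<forall>y. v y \<subseteq> S)"

text \<open>
  Intersecting with \<open>S\<close> makes \<^const>\<open>lfp\<close> and \<^const>\<open>gfp\<close>, which are taken over all subsets of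
  the state type, yield the least and greatest fixed point over the subsets of \<open>S\<close>; without it,
  \<open>\<nu>z. z\<close> would denote \<^const>\<open>UNIV\<close> instead of \<open>S\<close>.
\<close>

fun sem :: "'s set \<Rightarrow> ('a \<Rightarrow> ('s \<times> 's) set) \<Rightarrow> ('p \<Rightarrow> 's set) \<Rightarrow> ('p, 'a) form \<Rightarrow> 's set" where
  "sem S R v (Var y) = v y"
| "sem S R v (NVar y) = S - v y"
| "sem S R v Top = S"
| "sem S R v (Conj \<phi> \<psi>) = sem S R v \<phi> \<inter> sem S R v \<psi>"
| "sem S R v Bot = {}"
| "sem S R v (Disj \<phi> \<psi>) = sem S R v \<phi> \<union> sem S R v \<psi>"
| "sem S R v (Dia a \<phi>) = {s \<in> S. \<exists>t. (s, t) \<in> R a \<and> t \<in> sem S R v \<phi>}"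
| "sem S R v (Box a \<phi>) = {s \<in> S. \<forall>t. (s, t) \<in> R a \<longrightarrow> t \<in> sem S R v \<phi>}"
| "sem S R v (Mu z \<phi>) = lfp (\<lambda>A. S \<inter> sem S R (v(z := A)) \<phi>)"
| "sem S R v (Nu z \<phi>) = gfp (\<lambda>A. S \<inter> sem S R (v(z := A)) \<phi>)"

text \<open>
  HOL cannot quantify over types inside a formula, so the type of states is a parameter. By the
  finite model property of the modal \<open>\<mu>\<close>-calculus, two formulas that are equivalent over
  the models with states in one infinite type are equivalent over all models.
\<close>

definition equivalent :: "'s itself \<Rightarrow> ('p, 'a) form \<Rightarrow> ('p, 'a) form \<Rightarrow> bool" where
  "equivalent TYPE('s) \<phi> \<psi> \<longleftrightarrow>
     (\<forall>(S :: 's set) R v. kripke_model S R v \<longrightarrow> sem S R v \<phi> = sem S R v \<psi>)"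

text \<open>One list entry for each occurrence of a fixed-point binder.\<close>

fun binders :: "('p, 'a) form \<Rightarrow> 'p list" where
  "binders (Var y) = []"
| "binders (NVar y) = []"
| "binders Top = []"
| "binders (Conj \<phi> \<psi>) = binders \<phi> @ binders \<psi>"
| "binders Bot = []"
| "binders (Disj \<phi> \<psi>) = binders \<phi> @ binders \<psi>"
| "binders (Dia a \<phi>) = binders \<phi>"
| "binders (Box a \<phi>) = binders \<phi>"
| "binders (Mu z \<phi>) = z # binders \<phi>"
| "binders (Nu z \<phi>) = z # binders \<phi>"

definition bound_vars :: "('p, 'a) form \<Rightarrow> 'p set" where
  "bound_vars \<phi> = set (binders \<phi>)"

definition well_named :: "('p, 'a) form \<Rightarrow> bool" where
  "well_named \<phi> \<longleftrightarrow> bound_vars \<phi> \<inter> free_vars \<phi> = {} \<and> distinct (binders \<phi>)"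

text \<open>
  \<open>subst x \<theta> \<theta>' \<phi>\<close> replaces the free occurrences of the literals \<open>x\<close> and \<open>\<not> x\<close> by
  \<open>\<theta>\<close> and \<open>\<theta>'\<close>. It does not rename bound variables; below it only inserts a fresh
  variable or a constant, so no capture can occur.
\<close>

fun subst ::
    "'p \<Rightarrow> ('p, 'a) form \<Rightarrow> ('p, 'a) form \<Rightarrow> ('p, 'a) form \<Rightarrow> ('p, 'a) form" where
  "subst x \<theta> \<theta>' (Var y) = (if y = x then \<theta> else Var y)"
| "subst x \<theta> \<theta>' (NVar y) = (if y = x then \<theta>' else NVar y)"
| "subst x \<theta> \<theta>' Top = Top"
| "subst x \<theta> \<theta>' (Conj \<phi> \<psi>) = Conj (subst x \<theta> \<theta>' \<phi>) (subst x \<theta> \<theta>' \<psi>)"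
| "subst x \<theta> \<theta>' Bot = Bot"
| "subst x \<theta> \<theta>' (Disj \<phi> \<psi>) = Disj (subst x \<theta> \<theta>' \<phi>) (subst x \<theta> \<theta>' \<psi>)"
| "subst x \<theta> \<theta>' (Dia a \<phi>) = Dia a (subst x \<theta> \<theta>' \<phi>)"
| "subst x \<theta> \<theta>' (Box a \<phi>) = Box a (subst x \<theta> \<theta>' \<phi>)"
| "subst x \<theta> \<theta>' (Mu z \<phi>) = (if z = x then Mu z \<phi> else Mu z (subst x \<theta> \<theta>' \<phi>))"
| "subst x \<theta> \<theta>' (Nu z \<phi>) = (if z = x then Nu z \<phi> else Nu z (subst x \<theta> \<theta>' \<phi>))"

definition rename_free :: "'p \<Rightarrow> 'p \<Rightarrow> ('p, 'a) form \<Rightarrow> ('p, 'a) form" where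
  "rename_free x x' \<phi> = subst x (Var x') (NVar x') \<phi>"

definition subst_bot :: "'p \<Rightarrow> ('p, 'a) form \<Rightarrow> ('p, 'a) form" where
  "subst_bot x \<phi> = subst x Bot Top \<phi>"

text \<open>
  In \<open>hat x x' \<psi>\<close> and \<open>flat x x' \<psi>\<close>, the variable \<open>x\<close> is meant to be not bound in \<open>\<psi>\<close>, and
  \<open>x'\<close> (written \<open>x\<close> with a bar on paper) to be fresh.
\<close>

fun hat :: "'p \<Rightarrow> 'p \<Rightarrow> ('p, 'a) form \<Rightarrow> ('p, 'a) form" where
  "hat x x' (Var y) = Var y"
| "hat x x' (NVar y) = NVar y"
| "hat x x' Top = Top"
| "hat x x' (Conj \<phi> \<psi>) = Conj (hat x x' \<phi>) (hat x x' \<psi>)"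
| "hat x x' Bot = Bot"
| "hat x x' (Disj \<phi> \<psi>) = Disj (hat x x' \<phi>) (hat x x' \<psi>)"
| "hat x x' (Dia a \<phi>) = Dia a (hat x x' \<phi>)"
| "hat x x' (Box a \<phi>) = Box a (rename_free x x' \<phi>)"
| "hat x x' (Mu z \<phi>) = Mu z (hat x x' \<phi>)"
| "hat x x' (Nu z \<phi>) = Nu z (hat x x' \<phi>)"

definition flat :: "'p \<Rightarrow> 'p \<Rightarrow> ('p, 'a) form \<Rightarrow> ('p, 'a) form" where
  "flat x x' \<psi> = subst_bot x' (hat x x' \<psi>)"

text \<open>
  Every formula in \<open>C1 {x}\<close> is positive in \<open>x\<close>, and \<open>hat\<close> leaves literals outside boxes
  unchanged. Hence \<open>\<not> x\<close> is not equivalent to any \<open>\<psi>\<close> with \<open>C1 {x} (hat x x' \<psi>)\<close> (consider a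
  single state without transitions), and only formulas positive in \<open>x\<close> are normalised.
\<close>

inductive C1 :: "'p set \<Rightarrow> ('p, 'a) form \<Rightarrow> bool" where
  "x \<in> X \<Longrightarrow> C1 X (Var x)"
| "L_mu \<chi> \<Longrightarrow> vars \<chi> \<inter> X = {} \<Longrightarrow> C1 X \<chi>"
| "C1 X Top"
| "C1 X Bot"
| "C1 X \<phi> \<Longrightarrow> C1 X \<psi> \<Longrightarrow> C1 X (Conj \<phi> \<psi>)"
| "C1 X \<phi> \<Longrightarrow> C1 X \<psi> \<Longrightarrow> C1 X (Disj \<phi> \<psi>)"
| "C1 X \<phi> \<Longrightarrow> C1 X (Dia a \<phi>)"
| "C1 (X \<union> {z}) \<chi> \<Longrightarrow> C1 X (Mu z \<chi>)"
| "C1 (X \<union> {z}) \<chi> \<Longrightarrow> C1 X (Nu z \<chi>)"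

end

theory Submission
  imports Defs
begin

text \<open>
  A formula fails to be in \<open>C1 {x}\<close> after \<open>hat\<close> only because some bound variable \<open>z\<close> occurs under
  a box inside its own binder. For monotone \<open>f\<close> one has
  \<open>\<mu>z. f(z, z) = \<mu>z. f(z, \<mu>z. f(z, z))\<close>, and likewise for \<open>\<nu>\<close>; reading the second argument of
  \<open>f\<close> as the occurrences of \<open>z\<close> under a box, these occurrences can be replaced by the fixed point
  itself, in which \<open>z\<close> is no longer free. Doing this bottom-up, followed by a renaming of bound
  variables, produces \<open>\<psi>\<close>.
\<close>

section \<open>Occurrences under boxes and the bookkeeping of variables\<close>

text \<open>These are the variables with occurrences that \<open>hat\<close> can redirect.
  \<open>hat\<close> stops at the outermost box and renames every free occurrence inside it, hence
  \<open>free_vars\<close> in the box case.\<close>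

fun boxed_vars :: "('p, 'a) form \<Rightarrow> 'p set" where
  "boxed_vars (Var y) = {}"
| "boxed_vars (NVar y) = {}"
| "boxed_vars Top = {}"
| "boxed_vars (Conj \<phi> \<psi>) = boxed_vars \<phi> \<union> boxed_vars \<psi>"
| "boxed_vars Bot = {}"
| "boxed_vars (Disj \<phi> \<psi>) = boxed_vars \<phi> \<union> boxed_vars \<psi>"
| "boxed_vars (Dia a \<phi>) = boxed_vars \<phi>"
| "boxed_vars (Box a \<phi>) = free_vars \<phi>"
| "boxed_vars (Mu z \<phi>) = boxed_vars \<phi> - {z}"
| "boxed_vars (Nu z \<phi>) = boxed_vars \<phi> - {z}"

text \<open>The normal form to be reached. A box is unconstrained because its whole content enters
  \<open>C1\<close> as a single formula of \<open>L_mu\<close>, whatever fixed points it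
  contains.\<close>

fun unboxed_binders :: "('p, 'a) form \<Rightarrow> bool" where
  "unboxed_binders (Var y) = True"
| "unboxed_binders (NVar y) = True"
| "unboxed_binders Top = True"
| "unboxed_binders (Conj \<phi> \<psi>) = (unboxed_binders \<phi> \<and> unboxed_binders \<psi>)"
| "unboxed_binders Bot = True"
| "unboxed_binders (Disj \<phi> \<psi>) = (unboxed_binders \<phi> \<and> unboxed_binders \<psi>)"
| "unboxed_binders (Dia a \<phi>) = unboxed_binders \<phi>"
| "unboxed_binders (Box a \<phi>) = True"
| "unboxed_binders (Mu z \<phi>) = (z \<notin> boxed_vars \<phi> \<and> unboxed_binders \<phi>)"
| "unboxed_binders (Nu z \<phi>) = (z \<notin> boxed_vars \<phi> \<and> unboxed_binders \<phi>)"

inductive_cases L_mu_ConjE: "L_mu (Conj \<phi> \<psi>)"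
inductive_cases L_mu_DisjE: "L_mu (Disj \<phi> \<psi>)"
inductive_cases L_mu_DiaE: "L_mu (Dia a \<phi>)"
inductive_cases L_mu_BoxE: "L_mu (Box a \<phi>)"
inductive_cases L_mu_MuE: "L_mu (Mu z \<phi>)"
inductive_cases L_mu_NuE: "L_mu (Nu z \<phi>)"

lemma L_mu_simps [simp]:
  "L_mu (Var y)" "L_mu (NVar y)" "L_mu Top" "L_mu Bot"
  "L_mu (Conj \<phi> \<psi>) \<longleftrightarrow> L_mu \<phi> \<and> L_mu \<psi>"
  "L_mu (Disj \<phi> \<psi>) \<longleftrightarrow> L_mu \<phi> \<and> L_mu \<psi>"
  "L_mu (Dia a \<phi>) \<longleftrightarrow> L_mu \<phi>"
  "L_mu (Box a \<phi>) \<longleftrightarrow> L_mu \<phi>"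
  "L_mu (Mu z \<phi>) \<longleftrightarrow> L_mu \<phi> \<and> z \<notin> neg_vars \<phi>"
  "L_mu (Nu z \<phi>) \<longleftrightarrow> L_mu \<phi> \<and> z \<notin> neg_vars \<phi>"
  by (auto simp flip: positive_in_def intro: L_mu.intros
      elim: L_mu_ConjE L_mu_DisjE L_mu_DiaE L_mu_BoxE L_mu_MuE L_mu_NuE)

lemma bound_vars_simps [simp]:
  "bound_vars (Var y) = {}" "bound_vars (NVar y) = {}" "bound_vars Top = {}" "bound_vars Bot = {}"
  "bound_vars (Conj \<phi> \<psi>) = bound_vars \<phi> \<union> bound_vars \<psi>"
  "bound_vars (Disj \<phi> \<psi>) = bound_vars \<phi> \<union> bound_vars \<psi>"
  "bound_vars (Dia a \<phi>) = bound_vars \<phi>"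
  "bound_vars (Box a \<phi>) = bound_vars \<phi>"
  "bound_vars (Mu z \<phi>) = insert z (bound_vars \<phi>)"
  "bound_vars (Nu z \<phi>) = insert z (bound_vars \<phi>)"
  by (simp_all add: bound_vars_def)

lemma finite_free_vars [simp]: "finite (free_vars \<phi>)"
  by (induction \<phi>) auto

lemma finite_vars [simp]: "finite (vars \<phi>)"
  by (induction \<phi>) auto

lemma finite_bound_vars [simp]: "finite (bound_vars \<phi>)"
  by (simp add: bound_vars_def)

lemma vars_eq_free_Un_bound: "vars \<phi> = free_vars \<phi> \<union> bound_vars \<phi>"
  by (induction \<phi>) auto

text \<open>A binder does not remove its variable from \<open>neg_vars\<close>; it is the positivity
  condition of \<open>L_mu\<close> that keeps bound variables out.\<close>

lemma neg_vars_subset_free_vars: "L_mu \<phi> \<Longrightarrow> neg_vars \<phi> \<subseteq> free_vars \<phi>"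
  by (induction \<phi>) auto

lemma boxed_vars_subset_free_vars: "boxed_vars \<phi> \<subseteq> free_vars \<phi>"
  by (induction \<phi>) auto

section \<open>Semantics: dependence on free variables, monotonicity, substitution\<close>

lemma sem_cong_free_vars:
  "(\<And>y. y \<in> free_vars \<phi> \<Longrightarrow> v y = w y) \<Longrightarrow> sem S R v \<phi> = sem S R w \<phi>"
proof (induction \<phi> arbitrary: v w)
  case (Conj \<phi> \<psi>)
  have "sem S R v \<phi> = sem S R w \<phi>" "sem S R v \<psi> = sem S R w \<psi>"
    using Conj.prems by (auto intro!: Conj.IH)
  then show ?case by simp
next
  case (Disj \<phi> \<psi>)
  have "sem S R v \<phi> = sem S R w \<phi>" "sem S R v \<psi> = sem S R w \<psi>"
    using Disj.prems by (auto intro!: Disj.IH)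
  then show ?case by simp
next
  case (Dia a \<phi>)
  have "sem S R v \<phi> = sem S R w \<phi>"
    using Dia.prems by (auto intro!: Dia.IH)
  then show ?case by simp
next
  case (Box a \<phi>)
  have "sem S R v \<phi> = sem S R w \<phi>"
    using Box.prems by (auto intro!: Box.IH)
  then show ?case by simp
next
  case (Mu z \<phi>)
  have "sem S R (v(z := A)) \<phi> = sem S R (w(z := A)) \<phi>" for A
    using Mu.prems by (intro Mu.IH) auto
  then show ?case by simp
next
  case (Nu z \<phi>)
  have "sem S R (v(z := A)) \<phi> = sem S R (w(z := A)) \<phi>" for A
    using Nu.prems by (intro Nu.IH) auto
  then show ?case by simp
qed auto

text \<open>At a binder both valuations receive the same set, so the hypotheses pass to the body,
  and the fixed points are compared through their pointwise ordered functionals.\<close>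

lemma sem_mono:
  assumes "L_mu \<phi>" "\<And>y. v y \<subseteq> w y" "\<And>y. y \<in> neg_vars \<phi> \<Longrightarrow> v y = w y"
  shows "sem S R v \<phi> \<subseteq> sem S R w \<phi>"
  using assms
proof (induction \<phi> arbitrary: v w rule: form.induct)
  case (Conj \<phi> \<psi>)
  have "sem S R v \<phi> \<subseteq> sem S R w \<phi>"
    using Conj.prems by (intro Conj.IH(1)) auto
  moreover have "sem S R v \<psi> \<subseteq> sem S R w \<psi>"
    using Conj.prems by (intro Conj.IH(2)) auto
  ultimately show ?case by auto
next
  case (Disj \<phi> \<psi>)
  have "sem S R v \<phi> \<subseteq> sem S R w \<phi>"
    using Disj.prems by (intro Disj.IH(1)) auto
  moreover have "sem S R v \<psi> \<subseteq> sem S R w \<psi>"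
    using Disj.prems by (intro Disj.IH(2)) auto
  ultimately show ?case by auto
next
  case (Dia a \<phi>)
  have "sem S R v \<phi> \<subseteq> sem S R w \<phi>"
    using Dia.prems by (intro Dia.IH) auto
  then show ?case by auto
next
  case (Box a \<phi>)
  have "sem S R v \<phi> \<subseteq> sem S R w \<phi>"
    using Box.prems by (intro Box.IH) auto
  then show ?case by auto
next
  case (Mu z \<phi>)
  have "sem S R (v(z := A)) \<phi> \<subseteq> sem S R (w(z := A)) \<phi>" for A
    using Mu.prems by (intro Mu.IH) auto
  then show ?case by (auto intro!: lfp_mono)
next
  case (Nu z \<phi>)
  have "sem S R (v(z := A)) \<phi> \<subseteq> sem S R (w(z := A)) \<phi>" for A
    using Nu.prems by (intro Nu.IH) auto
  then show ?case by (auto intro!: gfp_mono)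
qed auto

lemma neg_vars_subst:
  "neg_vars (subst x \<theta> \<theta>' \<phi>) \<subseteq>
     neg_vars \<phi> \<union> neg_vars \<theta> \<union> (if x \<in> neg_vars \<phi> then neg_vars \<theta>' else {})"
  by (induction \<phi>) (auto split: if_splits)

text \<open>A negated variable of an inserted formula is free in it, so it differs from every binder
  of \<phi> and positivity survives.\<close>

lemma L_mu_subst:
  "\<lbrakk>L_mu \<phi>; L_mu \<theta>; L_mu \<theta>'; bound_vars \<phi> \<inter> (free_vars \<theta> \<union> free_vars \<theta>') = {}\<rbrakk>
    \<Longrightarrow> L_mu (subst x \<theta> \<theta>' \<phi>)"
proof (induction \<phi>)
  case (Mu z \<phi>)
  moreover have "z \<notin> neg_vars (subst x \<theta> \<theta>' \<phi>)"
    using Mu.prems neg_vars_subst[of x \<theta> \<theta>' \<phi>] neg_vars_subset_free_vars[of \<theta>]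
      neg_vars_subset_free_vars[of \<theta>'] by (auto split: if_splits)
  ultimately show ?case by auto
next
  case (Nu z \<phi>)
  moreover have "z \<notin> neg_vars (subst x \<theta> \<theta>' \<phi>)"
    using Nu.prems neg_vars_subst[of x \<theta> \<theta>' \<phi>] neg_vars_subset_free_vars[of \<theta>]
      neg_vars_subset_free_vars[of \<theta>'] by (auto split: if_splits)
  ultimately show ?case by auto
qed (auto simp: Int_Un_distrib Int_Un_distrib2)

text \<open>An inserted formula may land under a box, so all of its free variables have to be
  counted.\<close>

lemma boxed_vars_subst:
  "boxed_vars (subst x \<theta> \<theta>' \<phi>) \<subseteq> (boxed_vars \<phi> - {x}) \<union> free_vars \<theta> \<union> free_vars \<theta>'"
proof (induction \<phi>)
  case (Box a \<phi>)
  have "free_vars (subst x \<theta> \<theta>' \<phi>) \<subseteq> (free_vars \<phi> - {x}) \<union> free_vars \<theta> \<union> free_vars \<theta>'"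
    by (induction \<phi>) auto
  then show ?case by simp
qed (use boxed_vars_subset_free_vars[of \<theta>] boxed_vars_subset_free_vars[of \<theta>'] in auto)

text \<open>Making the complement condition depend on a negated occurrence of \<open>x\<close>
  serves two uses: renaming a variable, with \<open>NVar\<close> for \<theta>', and inserting a
  fixed point for a positive variable, with \<theta>' equal to \<theta>.\<close>

lemma sem_subst:
  assumes "bound_vars \<phi> \<inter> free_vars \<theta> = {}"
    and "\<And>v. x \<in> neg_vars \<phi> \<Longrightarrow> sem S R v \<theta>' = S - sem S R v \<theta>"
  shows "sem S R v (subst x \<theta> \<theta>' \<phi>) = sem S R (v(x := sem S R v \<theta>)) \<phi>"
  using assms
proof (induction \<phi> arbitrary: v)
  case (Mu z \<phi>)
  have "sem S R (v(z := A)) (subst x \<theta> \<theta>' \<phi>) = sem S R ((v(x := sem S R v \<theta>))(z := A)) \<phi>"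
    if "z \<noteq> x" for A
  proof -
    have "sem S R (v(z := A)) \<theta> = sem S R v \<theta>"
      using Mu.prems by (intro sem_cong_free_vars) auto
    moreover have "sem S R (v(z := A)) (subst x \<theta> \<theta>' \<phi>) =
        sem S R ((v(z := A))(x := sem S R (v(z := A)) \<theta>)) \<phi>"
      using Mu.prems by (intro Mu.IH) auto
    ultimately show ?thesis using that by (simp add: fun_upd_twist)
  qed
  \<comment> \<open>For \<open>z = x\<close> the substitution stops at the binder, and the update at
    \<open>x\<close> is overwritten by the one at \<open>z\<close>.\<close>
  then show ?case by (cases "z = x") (simp_all del: fun_upd_apply)
next
  case (Nu z \<phi>)
  have "sem S R (v(z := A)) (subst x \<theta> \<theta>' \<phi>) = sem S R ((v(x := sem S R v \<theta>))(z := A)) \<phi>"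
    if "z \<noteq> x" for A
  proof -
    have "sem S R (v(z := A)) \<theta> = sem S R v \<theta>"
      using Nu.prems by (intro sem_cong_free_vars) auto
    moreover have "sem S R (v(z := A)) (subst x \<theta> \<theta>' \<phi>) =
        sem S R ((v(z := A))(x := sem S R (v(z := A)) \<theta>)) \<phi>"
      using Nu.prems by (intro Nu.IH) auto
    ultimately show ?thesis using that by (simp add: fun_upd_twist)
  qed
  then show ?case by (cases "z = x") (simp_all del: fun_upd_apply)
qed (auto simp: Int_Un_distrib Int_Un_distrib2)

section \<open>Renaming and \<open>hat\<close>: effect on variables, positivity and
  semantics\<close>

lemma vars_rename_free:
  "x \<notin> bound_vars \<phi> \<Longrightarrow> vars (rename_free x x' \<phi>) \<subseteq> (vars \<phi> - {x}) \<union> {x'}"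
  unfolding rename_free_def by (induction \<phi>) auto

lemma free_vars_rename_free:
  "free_vars (rename_free x x' \<phi>) \<subseteq> (free_vars \<phi> - {x}) \<union> {x'}"
  unfolding rename_free_def by (induction \<phi>) auto

lemma neg_vars_rename_free:
  "neg_vars (rename_free x x' \<phi>) \<subseteq> neg_vars \<phi> \<union> (if x \<in> neg_vars \<phi> then {x'} else {})"
  unfolding rename_free_def using neg_vars_subst[of x "Var x'" "NVar x'" \<phi>] by (simp split: if_splits)

lemma bound_vars_rename_free [simp]: "bound_vars (rename_free x x' \<phi>) = bound_vars \<phi>"
  unfolding rename_free_def by (induction \<phi>) auto

lemma bound_vars_hat [simp]: "bound_vars (hat x x' \<phi>) = bound_vars \<phi>"
  by (induction \<phi>) auto

lemma neg_vars_hat: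
  "neg_vars (hat x x' \<phi>) \<subseteq> neg_vars \<phi> \<union> (if x \<in> neg_vars \<phi> then {x'} else {})"
proof (induction \<phi>)
  case (Box a \<phi>)
  then show ?case using neg_vars_rename_free[of x x' \<phi>] by simp
qed (auto split: if_splits)

lemma boxed_vars_hat: "boxed_vars (hat x x' \<phi>) \<subseteq> (boxed_vars \<phi> - {x}) \<union> {x'}"
proof (induction \<phi>)
  case (Box a \<phi>)
  then show ?case using free_vars_rename_free[of x x' \<phi>] by simp
qed auto

lemma L_mu_rename_free: "\<lbrakk>L_mu \<phi>; x' \<notin> bound_vars \<phi>\<rbrakk> \<Longrightarrow> L_mu (rename_free x x' \<phi>)"
  unfolding rename_free_def by (rule L_mu_subst) auto

lemma L_mu_hat: "\<lbrakk>L_mu \<phi>; x' \<notin> bound_vars \<phi>\<rbrakk> \<Longrightarrow> L_mu (hat x x' \<phi>)"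
proof (induction \<phi>)
  case (Mu z \<phi>)
  then show ?case using neg_vars_hat[of x x' \<phi>] by (auto split: if_splits)
next
  case (Nu z \<phi>)
  then show ?case using neg_vars_hat[of x x' \<phi>] by (auto split: if_splits)
qed (auto intro: L_mu_rename_free)

text \<open>Read backwards, this splits the occurrences of \<open>x\<close> into boxed and unboxed
  ones: the original formula is the diagonal of a function of two arguments.\<close>

lemma sem_hat:
  assumes "x \<notin> bound_vars \<phi>" "x' \<notin> bound_vars \<phi>" "v x' = v x"
  shows "sem S R v (hat x x' \<phi>) = sem S R v \<phi>"
  using assms
proof (induction \<phi> arbitrary: v)
  case (Box a \<phi>)
  have "sem S R v (rename_free x x' \<phi>) = sem S R (v(x := sem S R v (Var x'))) \<phi>"
    unfolding rename_free_def using Box.prems by (intro sem_subst) auto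
  also have "\<dots> = sem S R v \<phi>"
    using Box.prems by (intro sem_cong_free_vars) auto
  finally show ?case by simp
qed auto

text \<open>Since \<open>z'\<close> is fresh, \<open>hat\<close> creates it only under boxes. So the
  copies of \<theta> land where \<open>unboxed_binders\<close> demands nothing, and their free
  variables differ from the binders above them.\<close>

lemma unboxed_binders_subst_hat:
  assumes "unboxed_binders \<chi>" "z' \<notin> vars \<chi>" "bound_vars \<chi> \<inter> free_vars \<theta> = {}"
  shows "unboxed_binders (subst z' \<theta> \<theta> (hat z z' \<chi>))"
  using assms
proof (induction \<chi>)
  case (Mu y \<chi>)
  then have "y \<notin> boxed_vars (subst z' \<theta> \<theta> (hat z z' \<chi>))"
    using boxed_vars_subst[of z' \<theta> \<theta> "hat z z' \<chi>"] boxed_vars_hat[of z z' \<chi>] by auto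
  with Mu show ?case by auto
next
  case (Nu y \<chi>)
  then have "y \<notin> boxed_vars (subst z' \<theta> \<theta> (hat z z' \<chi>))"
    using boxed_vars_subst[of z' \<theta> \<theta> "hat z z' \<chi>"] boxed_vars_hat[of z z' \<chi>] by auto
  with Nu show ?case by auto
qed (auto simp: Int_Un_distrib Int_Un_distrib2)

section \<open>Diagonal fixed points\<close>

text \<open>The inner fixed point \<open>?L\<close> is a constant parameter. It is a fixed point of
  the outer functional, so \<open>?M\<close> lies below it; then \<open>f ?M ?M\<close> lies below
  \<open>f ?M ?L\<close>, which is \<open>?M\<close>, so \<open>?M\<close> is a prefixed point of
  the diagonal.\<close>

lemma lfp_diagonal:
  fixes f :: "'b::complete_lattice \<Rightarrow> 'b \<Rightarrow> 'b"
  assumes mono: "\<And>A B C D. A \<le> B \<Longrightarrow> C \<le> D \<Longrightarrow> f A C \<le> f B D"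
  shows "lfp (\<lambda>A. f A (lfp (\<lambda>A. f A A))) = lfp (\<lambda>A. f A A)"
proof (rule antisym)
  let ?L = "lfp (\<lambda>A. f A A)"
  let ?M = "lfp (\<lambda>A. f A ?L)"
  have L: "?L = f ?L ?L"
    by (rule lfp_unfold) (auto intro!: monoI mono)
  have M: "?M = f ?M ?L"
    by (rule lfp_unfold) (auto intro!: monoI mono)
  show le: "?M \<le> ?L"
    using L by (intro lfp_lowerbound) simp
  have "f ?M ?M \<le> f ?M ?L"
    using le by (intro mono) auto
  then show "?L \<le> ?M"
    using M by (intro lfp_lowerbound) simp
qed

lemma gfp_diagonal:
  fixes f :: "'b::complete_lattice \<Rightarrow> 'b \<Rightarrow> 'b"
  assumes mono: "\<And>A B C D. A \<le> B \<Longrightarrow> C \<le> D \<Longrightarrow> f A C \<le> f B D"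
  shows "gfp (\<lambda>A. f A (gfp (\<lambda>A. f A A))) = gfp (\<lambda>A. f A A)"
proof (rule antisym)
  let ?L = "gfp (\<lambda>A. f A A)"
  let ?M = "gfp (\<lambda>A. f A ?L)"
  have L: "?L = f ?L ?L"
    by (rule gfp_unfold) (auto intro!: monoI mono)
  have M: "?M = f ?M ?L"
    by (rule gfp_unfold) (auto intro!: monoI mono)
  show le: "?L \<le> ?M"
    using L by (intro gfp_upperbound) simp
  have "f ?M ?L \<le> f ?M ?M"
    using le by (intro mono) auto
  then show "?M \<le> ?L"
    using M by (intro gfp_upperbound) simp
qed

text \<open>Here \<open>f\<close> takes the unboxed occurrences of \<open>z\<close> as first
  argument and the boxed ones as second. The three claims are what the diagonal lemmas need:
  monotonicity, the original body as diagonal, and the substituted body as \<open>f\<close> with its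
  second argument fixed.\<close>

lemma sem_fixpoint_subst_hat:
  assumes f_def: "f = (\<lambda>A B. S \<inter> sem S R (v(z := A, z' := B)) (hat z z' \<chi>))"
    and \<chi>: "L_mu \<chi>" "z \<notin> neg_vars \<chi>" "z \<notin> bound_vars \<chi>"
    and z': "z' \<notin> vars \<chi>" "z' \<noteq> z"
  shows "A \<subseteq> B \<Longrightarrow> C \<subseteq> D \<Longrightarrow> f A C \<subseteq> f B D"
    and "f A A = S \<inter> sem S R (v(z := A)) \<chi>"
    and "\<lbrakk>z \<notin> free_vars \<theta>; bound_vars \<chi> \<inter> free_vars \<theta> = {}\<rbrakk> \<Longrightarrow>
      S \<inter> sem S R (v(z := A)) (subst z' \<theta> \<theta> (hat z z' \<chi>)) = f A (sem S R v \<theta>)"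
proof -
  have z'_free: "z' \<notin> free_vars \<chi>" "z' \<notin> bound_vars \<chi>" "z' \<notin> neg_vars \<chi>"
    using z' neg_vars_subset_free_vars[OF \<chi>(1)] by (auto simp: vars_eq_free_Un_bound)
  have pos: "z \<notin> neg_vars (hat z z' \<chi>)" "z' \<notin> neg_vars (hat z z' \<chi>)"
    using \<chi>(2) z'_free(3) neg_vars_hat[of z z' \<chi>] by auto
  show "f A C \<subseteq> f B D" if "A \<subseteq> B" "C \<subseteq> D"
  proof -
    have "sem S R (v(z := A, z' := C)) (hat z z' \<chi>) \<subseteq> sem S R (v(z := B, z' := D)) (hat z z' \<chi>)"
      using that pos z'_free(2) \<chi>(1) by (intro sem_mono L_mu_hat) auto
    then show ?thesis unfolding f_def by auto
  qed
  have "sem S R (v(z := A, z' := A)) (hat z z' \<chi>) = sem S R (v(z := A, z' := A)) \<chi>"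
    using \<chi>(3) z'_free(2) by (intro sem_hat) auto
  also have "\<dots> = sem S R (v(z := A)) \<chi>"
    using z'_free(1) by (intro sem_cong_free_vars) auto
  finally show "f A A = S \<inter> sem S R (v(z := A)) \<chi>"
    by (simp add: f_def)
  show "S \<inter> sem S R (v(z := A)) (subst z' \<theta> \<theta> (hat z z' \<chi>)) = f A (sem S R v \<theta>)"
    if "z \<notin> free_vars \<theta>" "bound_vars \<chi> \<inter> free_vars \<theta> = {}"
  proof -
    have "sem S R (v(z := A)) \<theta> = sem S R v \<theta>"
      using that by (intro sem_cong_free_vars) auto
    \<comment> \<open>The variable \<open>z'\<close> never occurs negated, so using \<theta> also
      for negated literals is harmless.\<close>
    moreover have "sem S R (v(z := A)) (subst z' \<theta> \<theta> (hat z z' \<chi>)) =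
        sem S R (v(z := A, z' := sem S R (v(z := A)) \<theta>)) (hat z z' \<chi>)"
      using that pos by (intro sem_subst) auto
    ultimately show ?thesis by (simp add: f_def)
  qed
qed

section \<open>Renaming bound variables apart\<close>

text \<open>The induction needs an arbitrary renaming \<rho> of free variables, because passing a
  binder changes it to \<open>\<rho>(z := z')\<close>, and an arbitrary set \<open>F\<close> of
  names to avoid, because names chosen elsewhere must not be reused.\<close>

lemma ex_rename_bound:
  fixes \<phi> :: "('p, 'a) form" and \<rho> :: "'p \<Rightarrow> 'q::infinite"
  assumes "L_mu \<phi>" "finite F"
  shows "\<exists>\<psi>. L_mu \<psi> \<and> distinct (binders \<psi>) \<and> bound_vars \<psi> \<inter> F = {} \<and>
    free_vars \<psi> = \<rho> ` free_vars \<phi> \<and> neg_vars \<psi> = \<rho> ` neg_vars \<phi> \<and>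
    boxed_vars \<psi> = \<rho> ` boxed_vars \<phi> \<and> (unboxed_binders \<phi> \<longrightarrow> unboxed_binders \<psi>) \<and>
    (\<forall>(S :: 's set) R v. sem S R v \<psi> = sem S R (v \<circ> \<rho>) \<phi>)"
    (is "\<exists>\<psi>. ?P F \<rho> \<phi> \<psi>")
  using assms
proof (induction \<phi> arbitrary: F \<rho> rule: form.induct)
  case (Var y)
  then show ?case by (intro exI[of _ "Var (\<rho> y)"]) auto
next
  case (NVar y)
  then show ?case by (intro exI[of _ "NVar (\<rho> y)"]) auto
next
  case Top
  then show ?case by (intro exI[of _ Top]) auto
next
  case Bot
  then show ?case by (intro exI[of _ Bot]) auto
next
  case (Conj \<phi>1 \<phi>2)
  obtain \<psi>1 where \<psi>1: "?P F \<rho> \<phi>1 \<psi>1" using Conj by fastforce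
  \<comment> \<open>Avoiding the binders of the left conjunct makes all binders distinct.\<close>
  obtain \<psi>2 where \<psi>2: "?P (F \<union> bound_vars \<psi>1) \<rho> \<phi>2 \<psi>2"
    using Conj.IH(2)[of "F \<union> bound_vars \<psi>1" \<rho>] Conj.prems by auto
  have "?P F \<rho> (Conj \<phi>1 \<phi>2) (Conj \<psi>1 \<psi>2)"
    using \<psi>1 \<psi>2 by (auto simp: image_Un bound_vars_def)
  then show ?case by (rule exI)
next
  case (Disj \<phi>1 \<phi>2)
  obtain \<psi>1 where \<psi>1: "?P F \<rho> \<phi>1 \<psi>1" using Disj by fastforce
  obtain \<psi>2 where \<psi>2: "?P (F \<union> bound_vars \<psi>1) \<rho> \<phi>2 \<psi>2"
    using Disj.IH(2)[of "F \<union> bound_vars \<psi>1" \<rho>] Disj.prems by auto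
  have "?P F \<rho> (Disj \<phi>1 \<phi>2) (Disj \<psi>1 \<psi>2)"
    using \<psi>1 \<psi>2 by (auto simp: image_Un bound_vars_def)
  then show ?case by (rule exI)
next
  case (Dia a \<phi>)
  obtain \<psi> where \<psi>: "?P F \<rho> \<phi> \<psi>" using Dia by fastforce
  have "?P F \<rho> (Dia a \<phi>) (Dia a \<psi>)" using \<psi> by auto
  then show ?case by (rule exI)
next
  case (Box a \<phi>)
  obtain \<psi> where \<psi>: "?P F \<rho> \<phi> \<psi>" using Box by fastforce
  have "?P F \<rho> (Box a \<phi>) (Box a \<psi>)" using \<psi> by auto
  then show ?case by (rule exI)
next
  case (Mu z \<phi>)
  \<comment> \<open>Avoiding the images of the free variables prevents capture: under the updated
    renaming, \<open>z\<close> is the only variable of \<open>free_vars \<phi>\<close> that can be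
    sent to \<open>z'\<close>.\<close>
  obtain z' where z': "z' \<notin> F \<union> \<rho> ` free_vars \<phi>"
    using ex_new_if_finite[OF infinite_UNIV, of "F \<union> \<rho> ` free_vars \<phi>"] Mu.prems by auto
  let ?\<rho> = "\<rho>(z := z')"
  obtain \<psi> where \<psi>: "?P (insert z' F) ?\<rho> \<phi> \<psi>"
    using Mu.IH[of "insert z' F" ?\<rho>] Mu.prems by auto
  have sub: "neg_vars \<phi> \<subseteq> free_vars \<phi>" "boxed_vars \<phi> \<subseteq> free_vars \<phi>"
    using Mu.prems by (simp_all add: neg_vars_subset_free_vars boxed_vars_subset_free_vars)
  have body: "sem S R (v(z' := A)) \<psi> = sem S R ((v \<circ> \<rho>)(z := A)) \<phi>"
    for S :: "'s set" and R v A
  proof -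
    have "sem S R (v(z' := A)) \<psi> = sem S R (v(z' := A) \<circ> ?\<rho>) \<phi>" using \<psi> by blast
    also have "\<dots> = sem S R ((v \<circ> \<rho>)(z := A)) \<phi>"
      using z' by (intro sem_cong_free_vars) auto
    finally show ?thesis .
  qed
  have img: "?\<rho> ` Y - {z'} = \<rho> ` (Y - {z})" "z' \<in> ?\<rho> ` Y \<longleftrightarrow> z \<in> Y"
    if "Y \<subseteq> free_vars \<phi>" for Y
    using that z' by (auto split: if_splits)
  from \<psi> have \<psi>_vars: "free_vars \<psi> = ?\<rho> ` free_vars \<phi>" "neg_vars \<psi> = ?\<rho> ` neg_vars \<phi>"
    "boxed_vars \<psi> = ?\<rho> ` boxed_vars \<phi>" by blast+
  have "free_vars (Mu z' \<psi>) = \<rho> ` free_vars (Mu z \<phi>)"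
    unfolding free_vars.simps \<psi>_vars by (rule img(1)) simp
  moreover have "boxed_vars (Mu z' \<psi>) = \<rho> ` boxed_vars (Mu z \<phi>)"
    unfolding boxed_vars.simps \<psi>_vars by (rule img(1)[OF sub(2)])
  \<comment> \<open>By positivity \<open>z\<close> is not in \<open>neg_vars \<phi>\<close>, so
    \<rho> and its update agree there.\<close>
  moreover have "neg_vars (Mu z' \<psi>) = \<rho> ` neg_vars (Mu z \<phi>)"
    unfolding neg_vars.simps \<psi>_vars using Mu.prems by (intro image_cong) auto
  moreover have "L_mu (Mu z' \<psi>)"
    using \<psi> Mu.prems img(2)[OF sub(1)] unfolding \<psi>_vars L_mu_simps by blast
  moreover have "unboxed_binders (Mu z \<phi>) \<longrightarrow> unboxed_binders (Mu z' \<psi>)"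
    using \<psi> img(2)[OF sub(2)] unfolding \<psi>_vars unboxed_binders.simps by blast
  moreover have "sem S R v (Mu z' \<psi>) = sem S R (v \<circ> \<rho>) (Mu z \<phi>)" for S :: "'s set" and R v
    unfolding sem.simps body ..
  moreover have "distinct (binders (Mu z' \<psi>))" "bound_vars (Mu z' \<psi>) \<inter> F = {}"
    using \<psi> z' by (auto simp: bound_vars_def)
  ultimately have "?P F \<rho> (Mu z \<phi>) (Mu z' \<psi>)" by blast
  then show ?case by (rule exI)
next
  case (Nu z \<phi>)
  obtain z' where z': "z' \<notin> F \<union> \<rho> ` free_vars \<phi>"
    using ex_new_if_finite[OF infinite_UNIV, of "F \<union> \<rho> ` free_vars \<phi>"] Nu.prems by auto
  let ?\<rho> = "\<rho>(z := z')"
  obtain \<psi> where \<psi>: "?P (insert z' F) ?\<rho> \<phi> \<psi>"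
    using Nu.IH[of "insert z' F" ?\<rho>] Nu.prems by auto
  have sub: "neg_vars \<phi> \<subseteq> free_vars \<phi>" "boxed_vars \<phi> \<subseteq> free_vars \<phi>"
    using Nu.prems by (simp_all add: neg_vars_subset_free_vars boxed_vars_subset_free_vars)
  have body: "sem S R (v(z' := A)) \<psi> = sem S R ((v \<circ> \<rho>)(z := A)) \<phi>"
    for S :: "'s set" and R v A
  proof -
    have "sem S R (v(z' := A)) \<psi> = sem S R (v(z' := A) \<circ> ?\<rho>) \<phi>" using \<psi> by blast
    also have "\<dots> = sem S R ((v \<circ> \<rho>)(z := A)) \<phi>"
      using z' by (intro sem_cong_free_vars) auto
    finally show ?thesis .
  qed
  have img: "?\<rho> ` Y - {z'} = \<rho> ` (Y - {z})" "z' \<in> ?\<rho> ` Y \<longleftrightarrow> z \<in> Y"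
    if "Y \<subseteq> free_vars \<phi>" for Y
    using that z' by (auto split: if_splits)
  from \<psi> have \<psi>_vars: "free_vars \<psi> = ?\<rho> ` free_vars \<phi>" "neg_vars \<psi> = ?\<rho> ` neg_vars \<phi>"
    "boxed_vars \<psi> = ?\<rho> ` boxed_vars \<phi>" by blast+
  have "free_vars (Nu z' \<psi>) = \<rho> ` free_vars (Nu z \<phi>)"
    unfolding free_vars.simps \<psi>_vars by (rule img(1)) simp
  moreover have "boxed_vars (Nu z' \<psi>) = \<rho> ` boxed_vars (Nu z \<phi>)"
    unfolding boxed_vars.simps \<psi>_vars by (rule img(1)[OF sub(2)])
  moreover have "neg_vars (Nu z' \<psi>) = \<rho> ` neg_vars (Nu z \<phi>)"
    unfolding neg_vars.simps \<psi>_vars using Nu.prems by (intro image_cong) auto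
  moreover have "L_mu (Nu z' \<psi>)"
    using \<psi> Nu.prems img(2)[OF sub(1)] unfolding \<psi>_vars L_mu_simps by blast
  moreover have "unboxed_binders (Nu z \<phi>) \<longrightarrow> unboxed_binders (Nu z' \<psi>)"
    using \<psi> img(2)[OF sub(2)] unfolding \<psi>_vars unboxed_binders.simps by blast
  moreover have "sem S R v (Nu z' \<psi>) = sem S R (v \<circ> \<rho>) (Nu z \<phi>)" for S :: "'s set" and R v
    unfolding sem.simps body ..
  moreover have "distinct (binders (Nu z' \<psi>))" "bound_vars (Nu z' \<psi>) \<inter> F = {}"
    using \<psi> z' by (auto simp: bound_vars_def)
  ultimately have "?P F \<rho> (Nu z \<phi>) (Nu z' \<psi>)" by blast
  then show ?case by (rule exI)
qed

lemma ex_well_named: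
  fixes \<phi> :: "('p::infinite, 'a) form"
  assumes "L_mu \<phi>" "finite F"
  obtains \<psi> where "L_mu \<psi>" "well_named \<psi>" "bound_vars \<psi> \<inter> F = {}"
    "free_vars \<psi> = free_vars \<phi>" "neg_vars \<psi> = neg_vars \<phi>"
    "unboxed_binders \<phi> \<Longrightarrow> unboxed_binders \<psi>"
    "\<And>(S :: 's set) R v. sem S R v \<psi> = sem S R v \<phi>"
proof -
  \<comment> \<open>With the identity renaming the free variables stay the same; adding them to the
    avoided set separates them from the bound ones.\<close>
  obtain \<psi> where "L_mu \<psi>" "distinct (binders \<psi>)" "bound_vars \<psi> \<inter> (F \<union> free_vars \<phi>) = {}"
    "free_vars \<psi> = free_vars \<phi>" "neg_vars \<psi> = neg_vars \<phi>"
    "unboxed_binders \<phi> \<Longrightarrow> unboxed_binders \<psi>"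
    "\<And>(S :: 's set) R v. sem S R v \<psi> = sem S R v \<phi>"
    using ex_rename_bound[OF assms(1), where F = "F \<union> free_vars \<phi>" and \<rho> = id and 's = 's] assms(2)
    by (auto simp: o_def id_def)
  then show thesis
    by (intro that[of \<psi>]) (auto simp: well_named_def)
qed

section \<open>Eliminating bound variables under boxes\<close>

text \<open>The inclusion of \<open>neg_vars\<close> is part of the claim because it carries the
  positivity of a binder's variable over to the transformed body.\<close>

lemma ex_unboxed_binders:
  fixes \<phi> :: "('p::infinite, 'a) form"
  assumes "L_mu \<phi>"
  shows "\<exists>\<psi>. L_mu \<psi> \<and> unboxed_binders \<psi> \<and> neg_vars \<psi> \<subseteq> neg_vars \<phi> \<and>
    (\<forall>(S :: 's set) R v. sem S R v \<psi> = sem S R v \<phi>)"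
    (is "\<exists>\<psi>. ?P \<phi> \<psi>")
  using assms
proof (induction \<phi> rule: form.induct)
  case (Var y)
  show ?case by (rule exI[of _ "Var y"]) simp
next
  case (NVar y)
  show ?case by (rule exI[of _ "NVar y"]) simp
next
  case Top
  show ?case by (rule exI[of _ "Top"]) simp
next
  case Bot
  show ?case by (rule exI[of _ "Bot"]) simp
next
  case (Conj \<phi>1 \<phi>2)
  then obtain \<psi>1 \<psi>2 where "?P \<phi>1 \<psi>1" "?P \<phi>2 \<psi>2" by auto
  then have "?P (Conj \<phi>1 \<phi>2) (Conj \<psi>1 \<psi>2)" by auto
  then show ?case by (rule exI)
next
  case (Disj \<phi>1 \<phi>2)
  then obtain \<psi>1 \<psi>2 where "?P \<phi>1 \<psi>1" "?P \<phi>2 \<psi>2" by auto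
  then have "?P (Disj \<phi>1 \<phi>2) (Disj \<psi>1 \<psi>2)" by auto
  then show ?case by (rule exI)
next
  case (Dia a \<phi>)
  then obtain \<psi> where "?P \<phi> \<psi>" by auto
  then have "?P (Dia a \<phi>) (Dia a \<psi>)" by auto
  then show ?case by (rule exI)
next
  case (Box a \<phi>)
  then show ?case by (intro exI[of _ "Box a \<phi>"]) auto
next
  case (Mu z \<phi>)
  then obtain \<psi> where \<psi>: "?P \<phi> \<psi>" by auto
  \<comment> \<open>The fixed point of \<chi> will be inserted below binders of \<chi> itself; a
    well-named copy rules out capture there.\<close>
  then obtain \<chi> where \<chi>: "L_mu \<chi>" "well_named \<chi>" "bound_vars \<chi> \<inter> {z} = {}"
    "free_vars \<chi> = free_vars \<psi>" "neg_vars \<chi> = neg_vars \<psi>" "unboxed_binders \<chi>"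
    "\<And>(S :: 's set) R v. sem S R v \<chi> = sem S R v \<psi>"
    using ex_well_named[of \<psi> "{z}", where 's = 's] by (metis finite.emptyI finite_insert)
  obtain z' where z': "z' \<notin> insert z (vars \<chi>)"
    using ex_new_if_finite[OF infinite_UNIV, of "insert z (vars \<chi>)"] by auto
  have z: "z \<notin> neg_vars \<chi>" "z \<notin> bound_vars \<chi>"
    using \<chi> \<psi> Mu.prems by auto
  let ?\<theta> = "Mu z \<chi>"
  \<comment> \<open>Exactly the boxed occurrences of \<open>z\<close> are replaced by the fixed
    point \<open>?\<theta>\<close>.\<close>
  let ?\<omega> = "subst z' ?\<theta> ?\<theta> (hat z z' \<chi>)"
  have disj: "bound_vars \<chi> \<inter> free_vars ?\<theta> = {}"
    using \<chi>(2) by (auto simp: well_named_def)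
  have "sem S R v (Mu z ?\<omega>) = sem S R v (Mu z \<phi>)" for S :: "'s set" and R v
  proof -
    define f where "f = (\<lambda>A B. S \<inter> sem S R (v(z := A, z' := B)) (hat z z' \<chi>))"
    note f = sem_fixpoint_subst_hat[OF f_def \<chi>(1) z]
    have mono: "f A C \<subseteq> f B D" if "A \<subseteq> B" "C \<subseteq> D" for A B C D
      using f(1) that z' by auto
    have diag: "sem S R v ?\<theta> = lfp (\<lambda>A. f A A)"
      using f(2) z' by simp
    have "sem S R v (Mu z ?\<omega>) = lfp (\<lambda>A. f A (sem S R v ?\<theta>))"
      using f(3)[of ?\<theta>] z' disj by simp
    also have "\<dots> = sem S R v ?\<theta>"
      unfolding diag by (rule lfp_diagonal[OF mono])
    also have "\<dots> = sem S R v (Mu z \<phi>)"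
      using \<chi>(7) \<psi> by (simp del: fun_upd_apply)
    finally show ?thesis .
  qed
  moreover have "unboxed_binders ?\<omega>"
    using \<chi>(6) z' disj by (intro unboxed_binders_subst_hat) auto
  \<comment> \<open>\<open>hat\<close> turns boxed occurrences of \<open>z\<close> into
    \<open>z'\<close>, and \<open>z\<close> is not free in \<open>?\<theta>\<close>.\<close>
  moreover have "z \<notin> boxed_vars ?\<omega>"
    using boxed_vars_subst[of z' ?\<theta> ?\<theta> "hat z z' \<chi>"] boxed_vars_hat[of z z' \<chi>] z' by auto
  moreover have "neg_vars ?\<omega> \<subseteq> neg_vars \<chi>"
    using neg_vars_subst[of z' ?\<theta> ?\<theta> "hat z z' \<chi>"] neg_vars_hat[of z z' \<chi>] z
    by (auto split: if_splits)
  moreover have "L_mu ?\<omega>"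
    using \<chi>(1) z z' disj by (intro L_mu_subst L_mu_hat) (auto simp: vars_eq_free_Un_bound)
  ultimately have "?P (Mu z \<phi>) (Mu z ?\<omega>)"
    using z \<chi>(5) \<psi> by auto
  then show ?case by (rule exI)
next
  \<comment> \<open>Dual to the previous case, through \<open>gfp_diagonal\<close>.\<close>
  case (Nu z \<phi>)
  then obtain \<psi> where \<psi>: "?P \<phi> \<psi>" by auto
  then obtain \<chi> where \<chi>: "L_mu \<chi>" "well_named \<chi>" "bound_vars \<chi> \<inter> {z} = {}"
    "free_vars \<chi> = free_vars \<psi>" "neg_vars \<chi> = neg_vars \<psi>" "unboxed_binders \<chi>"
    "\<And>(S :: 's set) R v. sem S R v \<chi> = sem S R v \<psi>"
    using ex_well_named[of \<psi> "{z}", where 's = 's] by (metis finite.emptyI finite_insert)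
  obtain z' where z': "z' \<notin> insert z (vars \<chi>)"
    using ex_new_if_finite[OF infinite_UNIV, of "insert z (vars \<chi>)"] by auto
  have z: "z \<notin> neg_vars \<chi>" "z \<notin> bound_vars \<chi>"
    using \<chi> \<psi> Nu.prems by auto
  let ?\<theta> = "Nu z \<chi>"
  let ?\<omega> = "subst z' ?\<theta> ?\<theta> (hat z z' \<chi>)"
  have disj: "bound_vars \<chi> \<inter> free_vars ?\<theta> = {}"
    using \<chi>(2) by (auto simp: well_named_def)
  have "sem S R v (Nu z ?\<omega>) = sem S R v (Nu z \<phi>)" for S :: "'s set" and R v
  proof -
    define f where "f = (\<lambda>A B. S \<inter> sem S R (v(z := A, z' := B)) (hat z z' \<chi>))"
    note f = sem_fixpoint_subst_hat[OF f_def \<chi>(1) z]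
    have mono: "f A C \<subseteq> f B D" if "A \<subseteq> B" "C \<subseteq> D" for A B C D
      using f(1) that z' by auto
    have diag: "sem S R v ?\<theta> = gfp (\<lambda>A. f A A)"
      using f(2) z' by simp
    have "sem S R v (Nu z ?\<omega>) = gfp (\<lambda>A. f A (sem S R v ?\<theta>))"
      using f(3)[of ?\<theta>] z' disj by simp
    also have "\<dots> = sem S R v ?\<theta>"
      unfolding diag by (rule gfp_diagonal[OF mono])
    also have "\<dots> = sem S R v (Nu z \<phi>)"
      using \<chi>(7) \<psi> by (simp del: fun_upd_apply)
    finally show ?thesis .
  qed
  moreover have "unboxed_binders ?\<omega>"
    using \<chi>(6) z' disj by (intro unboxed_binders_subst_hat) auto
  moreover have "z \<notin> boxed_vars ?\<omega>"
    using boxed_vars_subst[of z' ?\<theta> ?\<theta> "hat z z' \<chi>"] boxed_vars_hat[of z z' \<chi>] z' by auto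
  moreover have "neg_vars ?\<omega> \<subseteq> neg_vars \<chi>"
    using neg_vars_subst[of z' ?\<theta> ?\<theta> "hat z z' \<chi>"] neg_vars_hat[of z z' \<chi>] z
    by (auto split: if_splits)
  moreover have "L_mu ?\<omega>"
    using \<chi>(1) z z' disj by (intro L_mu_subst L_mu_hat) (auto simp: vars_eq_free_Un_bound)
  ultimately have "?P (Nu z \<phi>) (Nu z ?\<omega>)"
    using z \<chi>(5) \<psi> by auto
  then show ?case by (rule exI)
qed

section \<open>Membership in \<open>C1\<close>\<close>

text \<open>The set \<open>X\<close> collects the binders passed on the way down. Distinctness,
  positivity and \<open>unboxed_binders\<close> let each new binder join \<open>X\<close>, so
  \<open>x\<close> stays the only member of \<open>X\<close> that can occur under a box.\<close>

lemma C1_hat: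
  assumes "L_mu \<psi>" "unboxed_binders \<psi>" "distinct (binders \<psi>)"
    and "x' \<notin> vars \<psi>" "x' \<notin> X" "x \<notin> bound_vars \<psi>"
    and "X \<inter> bound_vars \<psi> = {}" "X \<inter> neg_vars \<psi> = {}" "X \<inter> boxed_vars \<psi> \<subseteq> {x}"
  shows "C1 X (hat x x' \<psi>)"
  using assms
proof (induction \<psi> arbitrary: X rule: form.induct)
  case (Var y)
  then show ?case by (cases "y \<in> X") (auto intro: C1.intros(1,2))
next
  case (Box a \<psi>)
  have "L_mu (Box a (rename_free x x' \<psi>))"
    using Box.prems by (auto intro: L_mu_rename_free simp: vars_eq_free_Un_bound)
  \<comment> \<open>The only possible member of \<open>X\<close> inside the box is \<open>x\<close>,
    and it is renamed to \<open>x'\<close>, which lies outside \<open>X\<close>.\<close>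
  moreover have "vars (Box a (rename_free x x' \<psi>)) \<inter> X = {}"
    using Box.prems vars_rename_free[of x \<psi> x'] by (auto simp: vars_eq_free_Un_bound)
  ultimately show ?case unfolding hat.simps by (rule C1.intros(2))
next
  case (Conj \<psi>1 \<psi>2)
  have "C1 X (hat x x' \<psi>1)"
    using Conj.prems by (intro Conj.IH(1)) auto
  moreover have "C1 X (hat x x' \<psi>2)"
    using Conj.prems by (intro Conj.IH(2)) auto
  ultimately show ?case unfolding hat.simps by (rule C1.intros(5))
next
  case (Disj \<psi>1 \<psi>2)
  have "C1 X (hat x x' \<psi>1)"
    using Disj.prems by (intro Disj.IH(1)) auto
  moreover have "C1 X (hat x x' \<psi>2)"
    using Disj.prems by (intro Disj.IH(2)) auto
  ultimately show ?case unfolding hat.simps by (rule C1.intros(6))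
next
  case (Dia a \<psi>)
  have "C1 X (hat x x' \<psi>)"
    using Dia.prems by (intro Dia.IH) auto
  then show ?case unfolding hat.simps by (rule C1.intros(7))
next
  case (Mu z \<psi>)
  have "C1 (X \<union> {z}) (hat x x' \<psi>)"
    using Mu.prems by (intro Mu.IH) (auto simp: bound_vars_def)
  then show ?case unfolding hat.simps by (rule C1.intros(8))
next
  case (Nu z \<psi>)
  have "C1 (X \<union> {z}) (hat x x' \<psi>)"
    using Nu.prems by (intro Nu.IH) (auto simp: bound_vars_def)
  then show ?case unfolding hat.simps by (rule C1.intros(9))
qed (auto intro: C1.intros(2-4))

text \<open>Inserting constants adds no variables, and the generators from \<open>X\<close> are
  untouched. At a binder of \<open>x'\<close> itself the substitution stops, so the induction
  hypothesis is used only for other binders.\<close>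

lemma C1_subst_bot:
  assumes "C1 X \<phi>" "x' \<notin> X"
  shows "C1 X (subst_bot x' \<phi>)"
  using assms
proof (induction rule: C1.induct)
  case (2 \<chi> X)
  have "vars (subst_bot x' \<chi>) \<subseteq> vars \<chi>"
    unfolding subst_bot_def by (induction \<chi>) auto
  moreover have "L_mu (subst_bot x' \<chi>)"
    unfolding subst_bot_def using 2 by (intro L_mu_subst) auto
  ultimately show ?case using 2 by (intro C1.intros(2)) auto
qed (auto simp: subst_bot_def intro: C1.intros(1,3-9))

theorem theorem5p17:
  fixes \<phi> :: "('p :: {countable, infinite}, 'a :: finite) form" and x :: 'p
  assumes "L_mu \<phi>" and "positive_in x \<phi>"
  shows "\<exists>\<psi> :: ('p, 'a) form.
           L_mu \<psi> \<and> equivalent TYPE('s :: infinite) \<phi> \<psi> \<and>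
           positive_in x \<psi> \<and> x \<notin> bound_vars \<psi> \<and> well_named \<psi> \<and>
           (\<forall>x'. x' \<noteq> x \<and> x' \<notin> vars \<psi> \<longrightarrow>
              C1 {x} (hat x x' \<psi>) \<and> C1 {x} (flat x x' \<psi>))"
proof -
  obtain \<chi> where \<chi>: "L_mu \<chi>" "unboxed_binders \<chi>" "neg_vars \<chi> \<subseteq> neg_vars \<phi>"
    "\<And>(S :: 's set) R v. sem S R v \<chi> = sem S R v \<phi>"
    using ex_unboxed_binders[OF assms(1), where 's = 's] by blast
  \<comment> \<open>A last renaming is needed because inserting fixed points duplicates binders, and
    because \<open>x\<close> may still be bound in \<chi>.\<close>
  obtain \<psi> where \<psi>: "L_mu \<psi>" "well_named \<psi>" "bound_vars \<psi> \<inter> {x} = {}"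
    "neg_vars \<psi> = neg_vars \<chi>" "unboxed_binders \<psi>"
    "\<And>(S :: 's set) R v. sem S R v \<psi> = sem S R v \<chi>"
    using ex_well_named[OF \<chi>(1), of "{x}", where 's = 's] \<chi>(2) by (metis finite.emptyI finite_insert)
  have pos: "x \<notin> neg_vars \<psi>"
    using \<psi>(4) \<chi>(3) assms(2) by (auto simp: positive_in_def)
  have "C1 {x} (hat x x' \<psi>)" if "x' \<noteq> x" "x' \<notin> vars \<psi>" for x'
    using \<psi> pos that by (intro C1_hat) (auto simp: well_named_def)
  moreover from this have "C1 {x} (flat x x' \<psi>)" if "x' \<noteq> x" "x' \<notin> vars \<psi>" for x'
    using that by (auto simp: flat_def intro: C1_subst_bot)
  ultimately show ?thesis
    using \<psi> \<chi>(4) pos by (intro exI[of _ \<psi>]) (auto simp: equivalent_def positive_in_def)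
qed

end
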